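(* Assume that all suffix domains $\mathcal X_0,\ldots,\mathcal X_N$ are nonempty, and that $$\begin{bmatrix}Q_i&M_i\\ M_i^{\top}&R_i\end{bmatrix}\succeq0,\qquad R_i\succ0\qquad(i=0,\ldots,N-1),\qquad Q_N\succeq0.$$ Then for every $i=0,\ldots,N-1$, $$\begin{bmatrix}\bar Q_i&\bar M_i\\ \bar M_i^{\top}&\bar R_i\end{bmatrix}\succeq0,\qquad \bar R_i\succ0\ \text{ whenever }\bar m_i>0,$$ and $\bar Q_N\succeq0$.
   Context: Setting: a horizon $N\ge1$, state dimensions $n_0,\ldots,n_N$, control dimensions $m_0,\ldots,m_{N-1}$ (possibly varying by stage), and real data of compatible sizes with $Q_i\in\mathbb R^{n_i\times n_i}$ ($i=0,\ldots,N$) and $R_i\in\mathbb R^{m_i\times m_i}$ symmetric, $M_i\in\mathbb R^{n_i\times m_i}$. These are the quadratic cost data of an equality-constrained LQR problem with stage costs $\tfrac12x^{\top}Q_ix+x^{\top}M_iu+\tfrac12u^{\top}R_iu+q_i^{\top}x+r_i^{\top}u$, terminal cost $\tfrac12x_N^{\top}Q_Nx_N+q_N^{\top}x_N$, and constraints $$x_{i+1}=A_ix_i+B_iu_i+c_i,\quad C_ix_i+D_iu_i+d_i=0,\quad E_ix_i+e_i=0\quad(i=0,\ldots,N-1),\qquad E_Nx_N+e_N=0.$$ Empty matrices represent absent constraints; no rank assumptions are made on the constraints. $\succeq0$ and $\succ0$ denote positive semidefiniteness and positive definiteness of symmetric matrices. Suffix domains: $\mathcal X_i\subseteq\mathbb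 R^{n_i}$ is the set of $x_i$ from which there exist controls $u_i,\ldots,u_{N-1}$ and states $x_{i+1},\ldots,x_N$ satisfying $x_{j+1}=A_jx_j+B_ju_j+c_j$, $C_jx_j+D_ju_j+d_j=0$ and $E_jx_j+e_j=0$ for all $j=i,\ldots,N-1$, and the terminal constraint $E_Nx_N+e_N=0$. It is an affine set represented as $\mathcal X_i=\{x_i:H_ix_i+h_i=0\}$ for some chosen $H_i,h_i$. Choose $t_i$ with $H_it_i+h_i=0$ and $T_i\in\mathbb R^{n_i\times\bar n_i}$ whose columns form a basis of the null space of $H_i$, so $\mathcal X_i=\{T_iz_i+t_i:z_i\in\mathbb R^{\bar n_i}\}$. Controls: for $i=0,\ldots,N-1$ let $$\Gamma_i=\begin{bmatrix}D_i\\ H_{i+1}B_i\end{bmatrix},\quad \Phi_i=\begin{bmatrix}C_iT_i\\ H_{i+1}A_iT_i\end{bmatrix},\quad \gamma_i=\begin{bmatrix}C_it_i+d_i\\ H_{i+1}(A_it_i+c_i)+h_{i+1}\end{bmatrix}.$$ Choose $Y_i,Z_i,y_i$ such that the columns of $Z_i\in\mathbb R^{m_i\times\bar m_i}$ form a basis of the null space of $\Gamma_i$ and, for every $z_i\in\mathbb R^{\bar n_i}$, the solution set in $u_i$ of $\Gamma_iu_i+\Phi_iz_i+\gamma_i=0$ is exactly $\{Y_iz_i+Z_iv_i+y_i:v_i\in\mathbb R^{\bar m_i}\}$. Reduced cost data: with $Q_i^z=T_i^{\top}Q_iT_i$ and $M_i^z=T_i^{\top}M_i$, $$\bar Q_i=Q_i^z+M_i^zY_i+Y_i^{\top}(M_i^z)^{\top}+Y_i^{\top}R_iY_i,\quad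 \bar M_i=M_i^zZ_i+Y_i^{\top}R_iZ_i,\quad \bar R_i=Z_i^{\top}R_iZ_i\quad(i=0,\ldots,N-1),$$ and $\bar Q_N=T_N^{\top}Q_NT_N$. *)

theory Defs
  imports "Jordan_Normal_Form.Matrix_Kernel"
begin

text \<open>
  Dimensions vary with the stage, so the data are dimension-carrying matrices and vectors indexed
  by the stage; any dimension may be zero. Values at out-of-range stages are irrelevant.
\<close>

definition pos_semidef :: "real mat \<Rightarrow> bool" where
  "pos_semidef A \<longleftrightarrow> A \<in> carrier_mat (dim_row A) (dim_row A) \<and> A\<^sup>T = A \<and>
     (\<forall>x \<in> carrier_vec (dim_row A). x \<bullet> (A *\<^sub>v x) \<ge> 0)"

definition pos_def :: "real mat \<Rightarrow> bool" where
  "pos_def A \<longleftrightarrow> A \<in> carrier_mat (dim_row A) (dim_row A) \<and> A\<^sup>T = A \<and>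
     (\<forall>x \<in> carrier_vec (dim_row A). x \<noteq> 0\<^sub>v (dim_row A) \<longrightarrow> x \<bullet> (A *\<^sub>v x) > 0)"

text \<open>
  \<open>kernel.basis\<close> speaks about a set of vectors, so repeated columns have to be excluded separately.
\<close>

definition cols_basis_of_kernel :: "real mat \<Rightarrow> real mat \<Rightarrow> bool" where
  "cols_basis_of_kernel T H \<longleftrightarrow> dim_row T = dim_col H \<and> distinct (cols T) \<and>
     kernel.basis (dim_col H) H (set (cols T))"

text \<open>
  The fields \<open>state_dim\<close>, \<open>ctrl_dim\<close>, \<open>mixed_dim\<close> and \<open>pure_dim\<close> are the numbers of states, of
  controls, of rows of \<open>C\<^sub>i, D\<^sub>i, d\<^sub>i\<close> and of rows of \<open>E\<^sub>i, e\<^sub>i\<close>.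
\<close>

record lqr_problem =
  horizon :: nat
  state_dim :: "nat \<Rightarrow> nat"
  ctrl_dim :: "nat \<Rightarrow> nat"
  mixed_dim :: "nat \<Rightarrow> nat"
  pure_dim :: "nat \<Rightarrow> nat"
  Amat :: "nat \<Rightarrow> real mat"
  Bmat :: "nat \<Rightarrow> real mat"
  cvec :: "nat \<Rightarrow> real vec"
  Cmat :: "nat \<Rightarrow> real mat"
  Dmat :: "nat \<Rightarrow> real mat"
  dvec :: "nat \<Rightarrow> real vec"
  Emat :: "nat \<Rightarrow> real mat"
  evec :: "nat \<Rightarrow> real vec"
  Qmat :: "nat \<Rightarrow> real mat"
  Mmat :: "nat \<Rightarrow> real mat"
  Rmat :: "nat \<Rightarrow> real mat"
  qvec :: "nat \<Rightarrow> real vec"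
  rvec :: "nat \<Rightarrow> real vec"

definition lqr_wf :: "lqr_problem \<Rightarrow> bool" where
  "lqr_wf P \<longleftrightarrow> horizon P \<ge> 1 \<and>
     (\<forall>i < horizon P.
        Amat P i \<in> carrier_mat (state_dim P (i + 1)) (state_dim P i) \<and>
        Bmat P i \<in> carrier_mat (state_dim P (i + 1)) (ctrl_dim P i) \<and>
        cvec P i \<in> carrier_vec (state_dim P (i + 1)) \<and>
        Cmat P i \<in> carrier_mat (mixed_dim P i) (state_dim P i) \<and>
        Dmat P i \<in> carrier_mat (mixed_dim P i) (ctrl_dim P i) \<and>
        dvec P i \<in> carrier_vec (mixed_dim P i) \<and>
        Mmat P i \<in> carrier_mat (state_dim P i) (ctrl_dim P i) \<and>
        Rmat P i \<in> carrier_mat (ctrl_dim P i) (ctrl_dim P i) \<and> (Rmat P i)\<^sup>T = Rmat P i \<and>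
        rvec P i \<in> carrier_vec (ctrl_dim P i)) \<and>
     (\<forall>i \<le> horizon P.
        Emat P i \<in> carrier_mat (pure_dim P i) (state_dim P i) \<and>
        evec P i \<in> carrier_vec (pure_dim P i) \<and>
        Qmat P i \<in> carrier_mat (state_dim P i) (state_dim P i) \<and> (Qmat P i)\<^sup>T = Qmat P i \<and>
        qvec P i \<in> carrier_vec (state_dim P i))"

definition suffix_feasible ::
    "lqr_problem \<Rightarrow> nat \<Rightarrow> (nat \<Rightarrow> real vec) \<Rightarrow> (nat \<Rightarrow> real vec) \<Rightarrow> bool" where
  "suffix_feasible P i x u \<longleftrightarrow>
     (\<forall>j \<in> {i..horizon P}. x j \<in> carrier_vec (state_dim P j)) \<and>
     (\<forall>j \<in> {i..<horizon P}. u j \<in> carrier_vec (ctrl_dim P j)) \<and>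
     (\<forall>j \<in> {i..<horizon P}.
        x (j + 1) = Amat P j *\<^sub>v x j + Bmat P j *\<^sub>v u j + cvec P j \<and>
        Cmat P j *\<^sub>v x j + Dmat P j *\<^sub>v u j + dvec P j = 0\<^sub>v (mixed_dim P j) \<and>
        Emat P j *\<^sub>v x j + evec P j = 0\<^sub>v (pure_dim P j)) \<and>
     Emat P (horizon P) *\<^sub>v x (horizon P) + evec P (horizon P) = 0\<^sub>v (pure_dim P (horizon P))"

definition suffix_domain :: "lqr_problem \<Rightarrow> nat \<Rightarrow> real vec set" where
  "suffix_domain P i = {x i | x u. suffix_feasible P i x u}"

text \<open>
  The chosen objects of the reduction. The fields \<open>dom_dim\<close>, \<open>red_state_dim\<close> and \<open>red_ctrl_dim\<close>
  are the number of rows of \<open>H\<^sub>i, h\<^sub>i\<close> and the numbers of columns of \<open>T\<^sub>i\<close> and of \<open>Z\<^sub>i\<close>.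
\<close>

record lqr_choice =
  dom_dim :: "nat \<Rightarrow> nat"
  red_state_dim :: "nat \<Rightarrow> nat"
  red_ctrl_dim :: "nat \<Rightarrow> nat"
  Hmat :: "nat \<Rightarrow> real mat"
  hvec :: "nat \<Rightarrow> real vec"
  Tmat :: "nat \<Rightarrow> real mat"
  tvec :: "nat \<Rightarrow> real vec"
  Ymat :: "nat \<Rightarrow> real mat"
  Zmat :: "nat \<Rightarrow> real mat"
  yvec :: "nat \<Rightarrow> real vec"

definition Gammamat :: "lqr_problem \<Rightarrow> lqr_choice \<Rightarrow> nat \<Rightarrow> real mat" where
  "Gammamat P S i = Dmat P i @\<^sub>r (Hmat S (i + 1) * Bmat P i)"

definition Phimat :: "lqr_problem \<Rightarrow> lqr_choice \<Rightarrow> nat \<Rightarrow> real mat" where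
  "Phimat P S i = (Cmat P i * Tmat S i) @\<^sub>r (Hmat S (i + 1) * Amat P i * Tmat S i)"

definition gammavec :: "lqr_problem \<Rightarrow> lqr_choice \<Rightarrow> nat \<Rightarrow> real vec" where
  "gammavec P S i = (Cmat P i *\<^sub>v tvec S i + dvec P i) @\<^sub>v
     (Hmat S (i + 1) *\<^sub>v (Amat P i *\<^sub>v tvec S i + cvec P i) + hvec S (i + 1))"

definition state_choice :: "lqr_problem \<Rightarrow> lqr_choice \<Rightarrow> nat \<Rightarrow> bool" where
  "state_choice P S i \<longleftrightarrow>
     Hmat S i \<in> carrier_mat (dom_dim S i) (state_dim P i) \<and>
     hvec S i \<in> carrier_vec (dom_dim S i) \<and>
     suffix_domain P i =
       {x \<in> carrier_vec (state_dim P i). Hmat S i *\<^sub>v x + hvec S i = 0\<^sub>v (dom_dim S i)} \<and>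
     tvec S i \<in> carrier_vec (state_dim P i) \<and>
     Hmat S i *\<^sub>v tvec S i + hvec S i = 0\<^sub>v (dom_dim S i) \<and>
     Tmat S i \<in> carrier_mat (state_dim P i) (red_state_dim S i) \<and>
     cols_basis_of_kernel (Tmat S i) (Hmat S i)"

definition control_choice :: "lqr_problem \<Rightarrow> lqr_choice \<Rightarrow> nat \<Rightarrow> bool" where
  "control_choice P S i \<longleftrightarrow>
     Ymat S i \<in> carrier_mat (ctrl_dim P i) (red_state_dim S i) \<and>
     Zmat S i \<in> carrier_mat (ctrl_dim P i) (red_ctrl_dim S i) \<and>
     yvec S i \<in> carrier_vec (ctrl_dim P i) \<and>
     cols_basis_of_kernel (Zmat S i) (Gammamat P S i) \<and>
     (\<forall>z \<in> carrier_vec (red_state_dim S i).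
        {u \<in> carrier_vec (ctrl_dim P i).
           Gammamat P S i *\<^sub>v u + Phimat P S i *\<^sub>v z + gammavec P S i
             = 0\<^sub>v (mixed_dim P i + dom_dim S (i + 1))} =
        {Ymat S i *\<^sub>v z + Zmat S i *\<^sub>v v + yvec S i | v. v \<in> carrier_vec (red_ctrl_dim S i)})"

definition lqr_choice_valid :: "lqr_problem \<Rightarrow> lqr_choice \<Rightarrow> bool" where
  "lqr_choice_valid P S \<longleftrightarrow>
     (\<forall>i \<le> horizon P. state_choice P S i) \<and> (\<forall>i < horizon P. control_choice P S i)"

definition Qz :: "lqr_problem \<Rightarrow> lqr_choice \<Rightarrow> nat \<Rightarrow> real mat" where
  "Qz P S i = (Tmat S i)\<^sup>T * Qmat P i * Tmat S i"

definition Mz :: "lqr_problem \<Rightarrow> lqr_choice \<Rightarrow> nat \<Rightarrow> real mat" where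
  "Mz P S i = (Tmat S i)\<^sup>T * Mmat P i"

definition Qbar :: "lqr_problem \<Rightarrow> lqr_choice \<Rightarrow> nat \<Rightarrow> real mat" where
  "Qbar P S i = (if i = horizon P then (Tmat S i)\<^sup>T * Qmat P i * Tmat S i
     else Qz P S i + Mz P S i * Ymat S i + (Ymat S i)\<^sup>T * (Mz P S i)\<^sup>T
       + (Ymat S i)\<^sup>T * Rmat P i * Ymat S i)"

definition Mbar :: "lqr_problem \<Rightarrow> lqr_choice \<Rightarrow> nat \<Rightarrow> real mat" where
  "Mbar P S i = Mz P S i * Zmat S i + (Ymat S i)\<^sup>T * Rmat P i * Zmat S i"

definition Rbar :: "lqr_problem \<Rightarrow> lqr_choice \<Rightarrow> nat \<Rightarrow> real mat" where
  "Rbar P S i = (Zmat S i)\<^sup>T * Rmat P i * Zmat S i"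

end

theory Submission
  imports Defs "Jordan_Normal_Form.DL_Rank"
begin

text \<open>
  Substituting \<open>x = T z\<close>, \<open>u = Y z + Z v\<close> into the stage cost is the congruence of the full cost matrix
  by \<open>W = [T, 0; Y, Z]\<close>, and its result is exactly the reduced cost matrix; likewise \<open>Rbar\<close> is the
  congruence of \<open>R\<close> by \<open>Z\<close>. Congruence preserves semidefiniteness, and it preserves definiteness
  when the transforming matrix is injective, which holds for \<open>Z\<close> because its columns are a basis.
\<close>

lemma transpose_congruence:
  fixes A W :: "'a :: comm_semiring_0 mat"
  assumes A: "A \<in> carrier_mat n n" and sym: "A\<^sup>T = A" and W: "W \<in> carrier_mat n m"
  shows "(W\<^sup>T * A * W)\<^sup>T = W\<^sup>T * A * W"
proof -
  have Wt: "W\<^sup>T \<in> carrier_mat m n" using W by simp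
  have "(W\<^sup>T * A * W)\<^sup>T = W\<^sup>T * (W\<^sup>T * A)\<^sup>T"
    by (rule transpose_mult[OF _ W]) (use Wt A in auto)
  also have "(W\<^sup>T * A)\<^sup>T = A * W"
    using transpose_mult[OF Wt A] sym by simp
  also have "W\<^sup>T * (A * W) = W\<^sup>T * A * W"
    by (rule assoc_mult_mat[OF Wt A W, symmetric])
  finally show ?thesis .
qed

text \<open>The transpose is the adjoint for the scalar product, so the outer
  \<open>W\<^sup>T\<close> moves onto \<open>x\<close>.\<close>

lemma quadratic_form_congruence:
  fixes A W :: "'a :: comm_semiring_0 mat"
  assumes A: "A \<in> carrier_mat n n" and W: "W \<in> carrier_mat n m" and x: "x \<in> carrier_vec m"
  shows "x \<bullet> ((W\<^sup>T * A * W) *\<^sub>v x) = (W *\<^sub>v x) \<bullet> (A *\<^sub>v (W *\<^sub>v x))"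
proof -
  have Wt: "W\<^sup>T \<in> carrier_mat m n" using W by simp
  have Wx: "W *\<^sub>v x \<in> carrier_vec n" using W x by simp
  have AWx: "A *\<^sub>v (W *\<^sub>v x) \<in> carrier_vec n" using A Wx by simp
  have "(W\<^sup>T * A * W) *\<^sub>v x = W\<^sup>T *\<^sub>v (A *\<^sub>v (W *\<^sub>v x))"
    using assoc_mult_mat_vec[OF mult_carrier_mat[OF Wt A] W x] assoc_mult_mat_vec[OF Wt A Wx]
    by simp
  moreover have "W\<^sup>T *\<^sub>v (A *\<^sub>v (W *\<^sub>v x)) \<in> carrier_vec m" using Wt AWx by simp
  ultimately show ?thesis
    \<comment> \<open>The adjoint rule has the transposed product as its left factor, so both scalar
      products are commuted to fit.\<close>
    using transpose_vec_mult_scalar[OF W x AWx] comm_scalar_prod[OF x]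
      comm_scalar_prod[OF Wx AWx] by metis
qed

lemma pos_semidef_congruence:
  assumes psd: "pos_semidef A" and A: "A \<in> carrier_mat n n" and W: "W \<in> carrier_mat n m"
  shows "pos_semidef (W\<^sup>T * A * W)"
proof -
  have sym: "A\<^sup>T = A" and nonneg: "\<And>x. x \<in> carrier_vec n \<Longrightarrow> x \<bullet> (A *\<^sub>v x) \<ge> 0"
    using psd A unfolding pos_semidef_def by auto
  have "x \<bullet> ((W\<^sup>T * A * W) *\<^sub>v x) \<ge> 0" if "x \<in> carrier_vec m" for x
    using nonneg[of "W *\<^sub>v x"] quadratic_form_congruence[OF A W that] W that by simp
  moreover have "W\<^sup>T * A * W \<in> carrier_mat m m" using A W by auto
  ultimately show ?thesis
    using transpose_congruence[OF A sym W] unfolding pos_semidef_def by auto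
qed

text \<open>Injectivity keeps \<open>W *\<^sub>v x\<close> nonzero for nonzero \<open>x\<close>, so
  strict positivity of \<open>A\<close> at that vector carries over.\<close>

lemma pos_def_congruence:
  assumes pd: "pos_def A" and A: "A \<in> carrier_mat n n" and W: "W \<in> carrier_mat n m"
    and inj: "\<And>x. x \<in> carrier_vec m \<Longrightarrow> W *\<^sub>v x = 0\<^sub>v n \<Longrightarrow> x = 0\<^sub>v m"
  shows "pos_def (W\<^sup>T * A * W)"
proof -
  have sym: "A\<^sup>T = A" and pos: "\<And>x. x \<in> carrier_vec n \<Longrightarrow> x \<noteq> 0\<^sub>v n \<Longrightarrow> x \<bullet> (A *\<^sub>v x) > 0"
    using pd A unfolding pos_def_def by auto
  have "x \<bullet> ((W\<^sup>T * A * W) *\<^sub>v x) > 0" if "x \<in> carrier_vec m" "x \<noteq> 0\<^sub>v m" for x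
    using pos[of "W *\<^sub>v x"] inj[of x] quadratic_form_congruence[OF A W that(1)] W that by auto
  moreover have "W\<^sup>T * A * W \<in> carrier_mat m m" using A W by auto
  ultimately show ?thesis
    using transpose_congruence[OF A sym W] unfolding pos_def_def by auto
qed

text \<open>A nonzero \<open>x\<close> with \<open>T *\<^sub>v x = 0\<^sub>v n\<close> would be a
  linear dependence among the columns. Distinctness matters: independence concerns the set of
  columns, in which repeated columns would merge.\<close>

lemma cols_basis_of_kernel_inj:
  assumes basis: "cols_basis_of_kernel T H" and T: "T \<in> carrier_mat n m"
    and x: "x \<in> carrier_vec m" and Tx: "T *\<^sub>v x = 0\<^sub>v n"
  shows "x = 0\<^sub>v m"
proof (rule ccontr)
  assume "x \<noteq> 0\<^sub>v m"
  have n: "dim_col H = n" and dist: "distinct (cols T)"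
    and b: "kernel.basis n H (set (cols T))"
    using basis T unfolding cols_basis_of_kernel_def by auto
  interpret kernel "dim_row H" n H by unfold_locales (use n in auto)
  have "Ker.lin_indpt (set (cols T))" and "set (cols T) \<subseteq> mat_kernel H"
    using b unfolding Ker.basis_def by auto
  \<comment> \<open>The basis property lives in the kernel as a vector space of its own;
    independence is carried over to the ambient space, where it meets the columns of
    \<open>T\<close>.\<close>
  then have "NC.lin_indpt (set (cols T))" using lindep_same by blast
  moreover have "NC.lin_dep (set (cols T))"
    by (rule NC.lin_depI[OF T x \<open>x \<noteq> 0\<^sub>v m\<close> Tx dist])
  ultimately show False by contradiction
qed

text \<open>Blockwise multiplication, with terms grouped as in \<open>Qbar\<close>,
  \<open>Mbar\<close> and \<open>Rbar\<close>. The zero block of \<open>W\<close> reflects that the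
  state does not depend on the reduced control \<open>v\<close>.\<close>

lemma block_congruence:
  fixes Q M R T Y Z :: "'a :: comm_ring_1 mat"
  assumes Q: "Q \<in> carrier_mat n n" and M: "M \<in> carrier_mat n m"
    and R: "R \<in> carrier_mat m m" and symR: "R\<^sup>T = R"
    and T: "T \<in> carrier_mat n k" and Y: "Y \<in> carrier_mat m k" and Z: "Z \<in> carrier_mat m l"
  defines "N \<equiv> T\<^sup>T * M * Z + Y\<^sup>T * R * Z"
  defines "W \<equiv> four_block_mat T (0\<^sub>m n l) Y Z"
  shows "W\<^sup>T * four_block_mat Q M M\<^sup>T R * W =
    four_block_mat (T\<^sup>T * Q * T + T\<^sup>T * M * Y + Y\<^sup>T * (T\<^sup>T * M)\<^sup>T + Y\<^sup>T * R * Y) N N\<^sup>T (Z\<^sup>T * R * Z)"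
proof -
  have c: "T\<^sup>T \<in> carrier_mat k n" "Y\<^sup>T \<in> carrier_mat k m" "Z\<^sup>T \<in> carrier_mat l m"
    "M\<^sup>T \<in> carrier_mat m n" using T Y Z M by auto
  have Wt: "W\<^sup>T = four_block_mat T\<^sup>T Y\<^sup>T (0\<^sub>m l n) Z\<^sup>T"
    unfolding W_def using transpose_four_block_mat[OF T zero_carrier_mat Y Z] by simp
  have WL: "W\<^sup>T * four_block_mat Q M M\<^sup>T R =
    four_block_mat (T\<^sup>T * Q + Y\<^sup>T * M\<^sup>T) (T\<^sup>T * M + Y\<^sup>T * R) (Z\<^sup>T * M\<^sup>T) (Z\<^sup>T * R)"
    unfolding Wt mult_four_block_mat[OF c(1,2) zero_carrier_mat c(3) Q M c(4) R]
    using Q M R c by simp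
  have TM: "(T\<^sup>T * M)\<^sup>T = M\<^sup>T * T" using transpose_mult[OF c(1) M] by simp
  have "(T\<^sup>T * M * Z)\<^sup>T = Z\<^sup>T * (M\<^sup>T * T)"
    using transpose_mult[OF mult_carrier_mat[OF c(1) M] Z] TM by simp
  \<comment> \<open>Symmetry of \<open>R\<close> enters here; it makes the lower left block of the
    product equal to \<open>N\<^sup>T\<close>.\<close>
  moreover have "(Y\<^sup>T * R * Z)\<^sup>T = Z\<^sup>T * (R * Y)"
    using transpose_mult[OF mult_carrier_mat[OF c(2) R] Z] transpose_mult[OF c(2) R] symR by simp
  ultimately have Nt: "N\<^sup>T = Z\<^sup>T * M\<^sup>T * T + Z\<^sup>T * R * Y"
    unfolding N_def using transpose_add[of "T\<^sup>T * M * Z" k l "Y\<^sup>T * R * Z"]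
      assoc_mult_mat[OF c(3,4) T] assoc_mult_mat[OF c(3) R Y] c M R Z by simp
  have "W\<^sup>T * four_block_mat Q M M\<^sup>T R * W = four_block_mat
    ((T\<^sup>T * Q + Y\<^sup>T * M\<^sup>T) * T + (T\<^sup>T * M + Y\<^sup>T * R) * Y)
    ((T\<^sup>T * Q + Y\<^sup>T * M\<^sup>T) * 0\<^sub>m n l + (T\<^sup>T * M + Y\<^sup>T * R) * Z)
    (Z\<^sup>T * M\<^sup>T * T + Z\<^sup>T * R * Y) (Z\<^sup>T * M\<^sup>T * 0\<^sub>m n l + Z\<^sup>T * R * Z)"
    \<comment> \<open>\<open>WL\<close> is stated for the folded \<open>W\<close>, so it has to
      rewrite before \<open>W\<close> is expanded.\<close>
    unfolding WL unfolding W_def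
    by (rule mult_four_block_mat[OF _ _ _ _ T zero_carrier_mat Y Z]) (use Q M R c in auto)
  moreover have "(T\<^sup>T * Q + Y\<^sup>T * M\<^sup>T) * 0\<^sub>m n l + (T\<^sup>T * M + Y\<^sup>T * R) * Z = N"
    unfolding N_def using Q M R c Z
    by (simp add: add_mult_distrib_mat[of _ k m])
  moreover have "Z\<^sup>T * M\<^sup>T * 0\<^sub>m n l + Z\<^sup>T * R * Z = Z\<^sup>T * R * Z"
    using R c Z by simp
  moreover have "(T\<^sup>T * Q + Y\<^sup>T * M\<^sup>T) * T + (T\<^sup>T * M + Y\<^sup>T * R) * Y
    = T\<^sup>T * Q * T + T\<^sup>T * M * Y + Y\<^sup>T * (T\<^sup>T * M)\<^sup>T + Y\<^sup>T * R * Y"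
  proof -
    have "(T\<^sup>T * Q + Y\<^sup>T * M\<^sup>T) * T = T\<^sup>T * Q * T + Y\<^sup>T * (T\<^sup>T * M)\<^sup>T"
      using add_mult_distrib_mat[of "T\<^sup>T * Q" k n "Y\<^sup>T * M\<^sup>T" T k] assoc_mult_mat[OF c(2,4) T]
        TM Q T c by simp
    moreover have "(T\<^sup>T * M + Y\<^sup>T * R) * Y = T\<^sup>T * M * Y + Y\<^sup>T * R * Y"
      using add_mult_distrib_mat[of "T\<^sup>T * M" k m "Y\<^sup>T * R" Y k] M R Y c by simp
    \<comment> \<open>Matrix addition commutes only under carrier conditions, so the reordering into
      the summand order of \<open>Qbar\<close> is checked entrywise.\<close>
    moreover have "A + B + (C + D) = A + C + B + D"
      if "A \<in> carrier_mat k k" "B \<in> carrier_mat k k" "C \<in> carrier_mat k k" "D \<in> carrier_mat k k"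
      for A B C D :: "'a mat"
      by (rule eq_matI) (use that in auto)
    moreover have "T\<^sup>T * Q * T \<in> carrier_mat k k" "Y\<^sup>T * (T\<^sup>T * M)\<^sup>T \<in> carrier_mat k k"
      "T\<^sup>T * M * Y \<in> carrier_mat k k" "Y\<^sup>T * R * Y \<in> carrier_mat k k"
      using Q M R T Y c by auto
    ultimately show ?thesis by metis
  qed
  ultimately show ?thesis unfolding Nt by simp
qed

theorem proposition6:
  fixes P :: lqr_problem and S :: lqr_choice
  assumes "lqr_wf P"
    and "lqr_choice_valid P S"
    and "\<forall>i \<le> horizon P. suffix_domain P i \<noteq> {}"
    and "\<forall>i < horizon P.
           pos_semidef (four_block_mat (Qmat P i) (Mmat P i) (Mmat P i)\<^sup>T (Rmat P i))"
    and "\<forall>i < horizon P. pos_def (Rmat P i)"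
    and "pos_semidef (Qmat P (horizon P))"
  shows "(\<forall>i < horizon P.
           pos_semidef (four_block_mat (Qbar P S i) (Mbar P S i) (Mbar P S i)\<^sup>T (Rbar P S i)) \<and>
           (red_ctrl_dim S i > 0 \<longrightarrow> pos_def (Rbar P S i))) \<and>
         pos_semidef (Qbar P S (horizon P))"
proof (intro conjI allI impI)
  fix i assume i: "i < horizon P"
  have Q: "Qmat P i \<in> carrier_mat (state_dim P i) (state_dim P i)"
    and M: "Mmat P i \<in> carrier_mat (state_dim P i) (ctrl_dim P i)"
    and R: "Rmat P i \<in> carrier_mat (ctrl_dim P i) (ctrl_dim P i)"
    and symR: "(Rmat P i)\<^sup>T = Rmat P i"
    using assms(1) i unfolding lqr_wf_def by auto
  have T: "Tmat S i \<in> carrier_mat (state_dim P i) (red_state_dim S i)"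
    and Y: "Ymat S i \<in> carrier_mat (ctrl_dim P i) (red_state_dim S i)"
    and Z: "Zmat S i \<in> carrier_mat (ctrl_dim P i) (red_ctrl_dim S i)"
    and basis: "cols_basis_of_kernel (Zmat S i) (Gammamat P S i)"
    using assms(2) i unfolding lqr_choice_valid_def state_choice_def control_choice_def by auto
  \<comment> \<open>The linear part of the substitution taking \<open>(z, v)\<close> to
    \<open>(x, u)\<close>; the offsets \<open>tvec\<close> and \<open>yvec\<close> do not affect the
    quadratic terms.\<close>
  define W where
    "W = four_block_mat (Tmat S i) (0\<^sub>m (state_dim P i) (red_ctrl_dim S i)) (Ymat S i) (Zmat S i)"
  have "W\<^sup>T * four_block_mat (Qmat P i) (Mmat P i) (Mmat P i)\<^sup>T (Rmat P i) * W
      = four_block_mat (Qbar P S i) (Mbar P S i) (Mbar P S i)\<^sup>T (Rbar P S i)"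
    unfolding W_def block_congruence[OF Q M R symR T Y Z]
    using i by (simp add: Qbar_def Qz_def Mz_def Mbar_def Rbar_def)
  moreover have "pos_semidef
      (W\<^sup>T * four_block_mat (Qmat P i) (Mmat P i) (Mmat P i)\<^sup>T (Rmat P i) * W)"
    by (rule pos_semidef_congruence[of _ "state_dim P i + ctrl_dim P i" _
          "red_state_dim S i + red_ctrl_dim S i"])
      (use assms(4) i four_block_carrier_mat[OF Q R] four_block_carrier_mat[OF T Z] W_def in auto)
  ultimately show
    "pos_semidef (four_block_mat (Qbar P S i) (Mbar P S i) (Mbar P S i)\<^sup>T (Rbar P S i))"
    by simp
  show "pos_def (Rbar P S i)"
    unfolding Rbar_def
    \<comment> \<open>\<open>Zmat S i\<close> is injective because its columns form a basis of the
      kernel of \<open>Gammamat P S i\<close>.\<close>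
    by (rule pos_def_congruence[OF _ R Z cols_basis_of_kernel_inj[OF basis Z]])
      (use assms(5) i in auto)
next
  have "Qmat P (horizon P) \<in> carrier_mat (state_dim P (horizon P)) (state_dim P (horizon P))"
    and "Tmat S (horizon P) \<in>
      carrier_mat (state_dim P (horizon P)) (red_state_dim S (horizon P))"
    using assms(1,2) unfolding lqr_wf_def lqr_choice_valid_def state_choice_def by auto
  \<comment> \<open>No control acts at the last stage: the first branch of \<open>Qbar\<close> is
    the plain congruence by \<open>Tmat\<close>.\<close>
  from pos_semidef_congruence[OF assms(6) this]
  show "pos_semidef (Qbar P S (horizon P))"
    unfolding Qbar_def by simp
qed

end
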